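(* Let $f,g\in \mathbb{C}[t]$ be non-constant polynomials. If $f$ and $g$ are multiplicatively independent, then there exists a polynomial $h\in\mathbb{C}[t]$ such that $\gcd(f^k-1,g^k-1)$ divides $h$ for every integer $k\geq 1$. If, in addition, $\gcd(f-1,g-1)=1$, then there are finitely many integers $d_1,\dots,d_m\geq 2$ such that for every integer $k\geq 1$ with $k\notin \bigcup_i d_i\mathbb{N}$ one has $\gcd(f^k-1,g^k-1)=1$.
   Context: Polynomials $f,g$ are called multiplicatively independent if $f^r\neq g^s$ for all integers $r,s\geq 1$. The gcd is taken in $\mathbb{C}[t]$ (normalized to be monic), and $d\mathbb{N}=\{d,2d,3d,\dots\}$. *)

theory Defs
  imports
    Complex_Main
    "HOL-Computational_Algebra.Computational_Algebra"
    "HOL-Computational_Algebra.Field_as_Ring"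
begin

definition mult_independent :: "complex poly \<Rightarrow> complex poly \<Rightarrow> bool" where
  "mult_independent f g \<longleftrightarrow> (\<forall>r s :: nat. r \<ge> 1 \<longrightarrow> s \<ge> 1 \<longrightarrow> f ^ r \<noteq> g ^ s)"

(* Field_as_Ring makes complex an instance of field_gcd with unit_factor x = x, so the
   library gcd on complex poly is the monic one. *)
lemma lead_coeff_gcd_complex_poly:
  fixes p q :: "complex poly"
  assumes "p \<noteq> 0 \<or> q \<noteq> 0"
  shows "lead_coeff (gcd p q) = 1"
proof -
  have "gcd p q \<noteq> 0"
    using assms by simp
  moreover have "unit_factor (gcd p q) = 1"
    using assms by (simp add: unit_factor_gcd)
  ultimately show ?thesis
    by (simp add: unit_factor_poly_def one_pCons)
qed

end

theory Submission
  imports Defs "Subresultants.Subresultant_Gcd"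
begin

text \<open>
  The points that matter lie on both lemniscates \<open>|f| = 1\<close> and \<open>|g| = 1\<close>, and if these meet in
  infinitely many points then \<open>f ^ n = c g ^ m\<close> with \<open>m = deg f\<close> and \<open>n = deg g\<close>. To see this,
  write \<open>F\<close>, \<open>G\<close> for the polynomials with conjugated coefficients: the equations
  \<open>f(z) F(w) = 1 = g(z) G(w)\<close> have the solutions \<open>(z, cnj z)\<close>, so their resultant in \<open>w\<close> is zero
  and every \<open>z\<close> with \<open>f(z) g(z) \<noteq> 0\<close> admits a solution \<open>w\<close>. As \<open>1 + |p(w)|\<close> is comparable to
  \<open>(1 + |w|) ^ deg p\<close> for every nonzero polynomial \<open>p\<close>, it follows that \<open>|f| ^ n \<le> K |g| ^ m\<close>
  off a finite set, hence \<open>g ^ m\<close> divides \<open>f ^ n\<close>, which has the same degree. At a point where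
  \<open>f\<close> and \<open>g\<close> are roots of unity one sees that \<open>c\<close> is one too, contradicting multiplicative
  independence. Therefore \<open>f ^ k - 1\<close> and \<open>g ^ k - 1\<close> have, over all \<open>k\<close>, only finitely many
  common zeros, and their multiplicities are bounded by \<open>deg f\<close>.
\<close>

section \<open>Divisibility criteria for complex polynomials\<close>

text \<open>Cancelling \<open>gcd p q\<close> leaves coprime cofactors; the assumption then leaves
  \<open>p'\<close> without roots, hence constant. As it ranges over all common factors
  \<open>d\<close>, applications need only check that their condition survives cancellation.\<close>

lemma complex_poly_dvdI:
  fixes p q :: "complex poly"
  assumes "p \<noteq> 0"
    and root: "\<And>d p' q' a. p = d * p' \<Longrightarrow> q = d * q' \<Longrightarrow> poly p' a = 0 \<Longrightarrow> poly q' a = 0"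
  shows "p dvd q"
proof -
  define d where "d = gcd p q"
  have "d \<noteq> 0" using assms(1) by (simp add: d_def)
  obtain p' q' where eq: "p = d * p'" "q = d * q'"
    unfolding d_def by (meson dvd_def gcd_dvd1 gcd_dvd2)
  have "coprime p' q'"
  proof -
    have "gcd p' q' dvd 1"
    proof -
      have "d * gcd p' q' dvd gcd p q" using eq by (metis gcd_greatest mult_dvd_mono dvd_refl gcd_dvd1 gcd_dvd2)
      then have "d * gcd p' q' dvd d * 1" by (simp add: d_def)
      then show ?thesis using \<open>d \<noteq> 0\<close> dvd_times_left_cancel_iff by blast
    qed
    then show ?thesis using is_unit_gcd by blast
  qed
  have "degree p' = 0"
  proof (rule ccontr)
    assume "degree p' \<noteq> 0"
    then obtain a where a: "poly p' a = 0"
      by (metis constant_degree fundamental_theorem_of_algebra)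
    with root eq have "poly q' a = 0" by blast
    with a have "[:-a, 1:] dvd p'" "[:-a, 1:] dvd q'" by (simp_all add: poly_eq_0_iff_dvd)
    with \<open>coprime p' q'\<close> have "is_unit [:-a, 1:]" by (meson coprime_common_divisor)
    then show False by (simp add: is_unit_iff_degree)
  qed
  moreover have "p' \<noteq> 0" using assms(1) eq by auto
  ultimately have "p' dvd 1" by (simp add: is_unit_iff_degree)
  then show ?thesis unfolding eq by (meson dvd_refl dvd_trans mult_dvd_mono one_dvd)
qed

lemma complex_poly_dvd_if_order_le:
  fixes p q :: "complex poly"
  assumes "p \<noteq> 0" "q \<noteq> 0" and le: "\<And>a. poly p a = 0 \<Longrightarrow> Polynomial.order a p \<le> Polynomial.order a q"
  shows "p dvd q"
proof (rule complex_poly_dvdI[OF assms(1)])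
  fix d p' q' a
  assume eq: "p = d * p'" "q = d * q'" and a: "poly p' a = 0"
  have "Polynomial.order a p = Polynomial.order a d + Polynomial.order a p'"
       "Polynomial.order a q = Polynomial.order a d + Polynomial.order a q'"
    using eq assms(1,2) by (simp_all add: order_mult)
  moreover have "Polynomial.order a p' \<noteq> 0" using a eq assms(1) by (auto simp: order_root)
  moreover have "poly p a = 0" using a eq by simp
  ultimately have "Polynomial.order a q' \<noteq> 0" using le[of a] by linarith
  then show "poly q' a = 0" by (simp add: order_root)
qed

lemma complex_poly_dvd_if_norm_le:
  fixes p q :: "complex poly"
  assumes "q \<noteq> 0" "finite S" and le: "\<And>z. z \<notin> S \<Longrightarrow> norm (poly p z) \<le> K * norm (poly q z)"
  shows "q dvd p"
proof (rule complex_poly_dvdI[OF assms(1)])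
  fix d q' p' a
  assume eq: "q = d * q'" "p = d * p'" and a: "poly q' a = 0"
  have fin: "finite (S \<union> {z. poly d z = 0})"
    using assms(1,2) eq by (auto intro!: poly_roots_finite)
  \<comment> \<open>The filter is punctured because \<open>a\<close> itself may lie in the excluded
    set; continuity then carries the bound to \<open>a\<close>.\<close>
  have "eventually (\<lambda>z. z \<notin> (S \<union> {z. poly d z = 0})) (at a)"
    using eventually_ball_finite[OF fin, of "\<lambda>z s. z \<noteq> s" "at a"]
    by (auto simp: eventually_neq_at_within elim: eventually_mono)
  then have "eventually (\<lambda>z. norm (poly p' z) \<le> K * norm (poly q' z)) (at a)"
  proof eventually_elim
    case (elim z)
    then have "norm (poly d z) * norm (poly p' z) \<le> norm (poly d z) * (K * norm (poly q' z))"
      using le[of z] eq by (simp add: norm_mult mult_ac)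
    with elim show ?case by simp
  qed
  moreover have "((\<lambda>z. norm (poly p' z)) \<longlongrightarrow> norm (poly p' a)) (at a)"
    by (intro tendsto_intros)
  moreover have "((\<lambda>z. K * norm (poly q' z)) \<longlongrightarrow> K * norm (poly q' a)) (at a)"
    by (intro tendsto_intros)
  ultimately have "norm (poly p' a) \<le> K * norm (poly q' a)"
    by (intro tendsto_le[of "at a"]) auto
  with a show "poly p' a = 0" by simp
qed

section \<open>Growth of polynomials\<close>

text \<open>Adding 1 to both norms makes the comparison global: zeros of \<open>p\<close> and small
  \<open>z\<close> need no exception, here or in the lower bound.\<close>

lemma poly_growth_upper:
  fixes p :: "complex poly"
  obtains C where "C > 0" "\<And>z. 1 + norm (poly p z) \<le> C * (1 + norm z) ^ degree p"
proof
  define C where "C = 1 + (\<Sum>i\<le>degree p. norm (coeff p i))"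
  show "C > 0" unfolding C_def by (simp add: add_pos_nonneg sum_nonneg)
  fix z :: complex
  have "norm (poly p z) \<le> (\<Sum>i\<le>degree p. norm (coeff p i * z ^ i))"
    unfolding poly_altdef by (rule norm_sum)
  also have "\<dots> \<le> (\<Sum>i\<le>degree p. norm (coeff p i) * (1 + norm z) ^ degree p)"
  proof (rule sum_mono)
    fix i assume "i \<in> {..degree p}"
    then have "norm z ^ i \<le> (1 + norm z) ^ degree p"
      by (meson atMost_iff add_increasing norm_ge_zero order_refl order_trans power_increasing
          power_mono zero_le_one le_add_same_cancel1)
    then show "norm (coeff p i * z ^ i) \<le> norm (coeff p i) * (1 + norm z) ^ degree p"
      by (simp add: norm_mult norm_power mult_left_mono)
  qed
  finally have "norm (poly p z) \<le> (\<Sum>i\<le>degree p. norm (coeff p i)) * (1 + norm z) ^ degree p"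
    by (simp add: sum_distrib_right)
  moreover have "1 \<le> (1 + norm z) ^ degree p" by simp
  ultimately show "1 + norm (poly p z) \<le> C * (1 + norm z) ^ degree p"
    unfolding C_def distrib_right mult_1 by linarith
qed

lemma poly_growth_lower:
  fixes p :: "complex poly"
  assumes "p \<noteq> 0"
  obtains C where "C > 0" "\<And>z. (1 + norm z) ^ degree p \<le> C * (1 + norm (poly p z))"
proof -
  let ?n = "degree p" and ?l = "norm (lead_coeff p)"
  have l: "?l > 0" using assms by simp
  have "((\<lambda>z. norm (poly p z / z ^ ?n)) \<longlongrightarrow> ?l) at_infinity"
    by (intro tendsto_norm poly_divide_tendsto_aux)
  then have "eventually (\<lambda>z. norm (poly p z / z ^ ?n) > ?l / 2) at_infinity"
    using l by (auto dest: order_tendstoD(1)[where a = "?l/2"])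
  then obtain R where R: "\<And>z. norm z \<ge> R \<Longrightarrow> norm (poly p z / z ^ ?n) > ?l / 2"
    by (auto simp: eventually_at_infinity)
  define M where "M = max R 1"
  \<comment> \<open>The first entry serves the disc \<open>norm z \<le> M\<close>; the second serves
    its complement, where the leading term dominates and
    \<open>1 + norm z \<le> 2 * norm z\<close>.\<close>
  define C where "C = max ((1 + M) ^ ?n) (2 ^ ?n * (2 / ?l))"
  have "M \<ge> 1" by (simp add: M_def)
  show ?thesis
  proof (rule that)
    have "(1 + M) ^ ?n > 0" using \<open>M \<ge> 1\<close> by simp
    then show "C > 0" unfolding C_def by (simp add: less_max_iff_disj)
    then have C0: "C \<ge> 0" by simp
    fix z :: complex
    show "(1 + norm z) ^ ?n \<le> C * (1 + norm (poly p z))"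
    proof (cases "norm z \<le> M")
      case True
      then have "(1 + norm z) ^ ?n \<le> (1 + M) ^ ?n" by (intro power_mono) auto
      also have "\<dots> \<le> C" by (simp add: C_def)
      also have "\<dots> \<le> C * (1 + norm (poly p z))" using C0 by (simp add: distrib_left)
      finally show ?thesis .
    next
      case False
      then have z: "norm z \<ge> 1" "norm z \<ge> R" by (auto simp: M_def)
      then have "norm z ^ ?n > 0" by (intro zero_less_power) linarith
      then have "norm (poly p z) \<ge> ?l / 2 * norm z ^ ?n"
        using R[OF z(2)] by (simp add: norm_divide norm_power pos_less_divide_eq)
      then have *: "norm z ^ ?n \<le> 2 / ?l * norm (poly p z)" using l by (simp add: field_simps)
      have "(1 + norm z) ^ ?n \<le> (2 * norm z) ^ ?n" using z by (intro power_mono) auto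
      also have "\<dots> \<le> 2 ^ ?n * (2 / ?l * norm (poly p z))"
        unfolding power_mult_distrib using * by (intro mult_left_mono) auto
      also have "\<dots> \<le> C * norm (poly p z)"
        by (simp only: mult.assoc[symmetric]) (intro mult_right_mono, auto simp: C_def)
      also have "\<dots> \<le> C * (1 + norm (poly p z))" using C0 by (simp add: distrib_left)
      finally show ?thesis .
    qed
  qed
qed

section \<open>Elimination by resultants\<close>

text \<open>The resultant in \<open>w\<close> of the two defining equations is a polynomial in \<open>z\<close>, so it vanishes
  identically as soon as it has infinitely many zeros.\<close>

lemma infinite_common_solutions_imp_all:
  fixes f g F G :: "complex poly"
  assumes deg: "degree F \<noteq> 0" "degree G \<noteq> 0"
    and inf: "infinite {z. \<exists>w. poly f z * poly F w = 1 \<and> poly g z * poly G w = 1}"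
    and z: "poly f z \<noteq> 0" "poly g z \<noteq> 0"
  shows "\<exists>w. poly f z * poly F w = 1 \<and> poly g z * poly G w = 1"
proof -
  \<comment> \<open>Bivariate polynomials with \<open>w\<close> as the outer variable and
    \<open>z\<close> in the coefficients; \<open>ev z\<close> specialises \<open>z\<close>.\<close>
  define A where "A = Polynomial.smult f (map_poly (\<lambda>c. [:c:]) F) - 1"
  define B where "B = Polynomial.smult g (map_poly (\<lambda>c. [:c:]) G) - 1"
  define ev where "ev = (\<lambda>z (c :: complex poly). poly c z)"
  have hom: "comm_ring_hom (ev z)" for z
    by unfold_locales (auto simp: ev_def)
  have "f \<noteq> 0" "g \<noteq> 0" using z by auto
  have evA: "map_poly (ev z) A = Polynomial.smult (poly f z) F - 1" for z
    by (rule poly_eqI) (auto simp: A_def ev_def coeff_map_poly coeff_1)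
  have evB: "map_poly (ev z) B = Polynomial.smult (poly g z) G - 1" for z
    by (rule poly_eqI) (auto simp: B_def ev_def coeff_map_poly coeff_1)
  have dsub: "degree (p - 1) = degree p" if "degree p \<noteq> 0" for p :: "'a :: comm_ring_1 poly"
    using that degree_add_eq_left[of "-1" p] by simp
  have dA: "degree A = degree F" and dB: "degree B = degree G"
    using deg \<open>f \<noteq> 0\<close> \<open>g \<noteq> 0\<close> unfolding A_def B_def by (simp_all add: dsub degree_map_poly)
  have res: "poly (resultant A B) z = 0 \<longleftrightarrow>
      (\<exists>w. poly f z * poly F w = 1 \<and> poly g z * poly G w = 1)"
    if z: "poly f z \<noteq> 0" "poly g z \<noteq> 0" for z
  proof -
    let ?P = "Polynomial.smult (poly f z) F - 1" and ?Q = "Polynomial.smult (poly g z) G - 1"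
    \<comment> \<open>The leading coefficients in \<open>w\<close> are constant multiples of
      \<open>poly f z\<close> and \<open>poly g z\<close>. Where these do not vanish, both degrees
      survive specialisation, which therefore commutes with the resultant.\<close>
    have d: "degree ?P = degree F" "degree ?Q = degree G"
      using z deg by (simp_all add: dsub)
    have "?P \<noteq> 0" using d deg by auto
    have "resultant ?P ?Q = ev z (resultant A B)"
      using comm_ring_hom.resultant_map_poly[OF hom, of z A B] by (simp add: evA evB d dA dB)
    then have "poly (resultant A B) z = 0 \<longleftrightarrow> degree (gcd ?P ?Q) \<noteq> 0"
      using resultant_0_gcd[of ?P ?Q] by (simp add: ev_def)
    also have "\<dots> \<longleftrightarrow> (\<exists>w. poly (gcd ?P ?Q) w = 0)"
    proof
      assume "degree (gcd ?P ?Q) \<noteq> 0"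
      then show "\<exists>w. poly (gcd ?P ?Q) w = 0"
        by (metis constant_degree fundamental_theorem_of_algebra)
    next
      assume "\<exists>w. poly (gcd ?P ?Q) w = 0"
      then show "degree (gcd ?P ?Q) \<noteq> 0"
        using \<open>?P \<noteq> 0\<close> by (metis degree_eq_zeroE gcd_eq_0_iff mult_zero_right pCons_eq_0_iff
            poly_0 poly_pCons add.right_neutral)
    qed
    also have "\<dots> \<longleftrightarrow> (\<exists>w. poly ?P w = 0 \<and> poly ?Q w = 0)"
      by (simp only: poly_eq_0_iff_dvd gcd_greatest_iff)
    finally show ?thesis by simp
  qed
  have "{z. \<exists>w. poly f z * poly F w = 1 \<and> poly g z * poly G w = 1} \<subseteq> {z. poly (resultant A B) z = 0}"
  proof clarify
    fix z w assume "poly f z * poly F w = 1" "poly g z * poly G w = 1"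
    then show "poly (resultant A B) z = 0" by (subst res) auto
  qed
  with inf have "resultant A B = 0"
    using finite_subset poly_roots_finite by blast
  then show ?thesis using res[OF z] by simp
qed

text \<open>The exponents equalise the degrees: both sides are of order
  \<open>(1 + norm z) ^ (degree p * degree q)\<close>.\<close>

lemma poly_growth_compare:
  fixes p q :: "complex poly"
  assumes "q \<noteq> 0"
  obtains C where "C > 0"
    "\<And>z. (1 + norm (poly p z)) ^ degree q \<le> C * (1 + norm (poly q z)) ^ degree p"
proof -
  obtain A where A: "A > 0" "\<And>z. 1 + norm (poly p z) \<le> A * (1 + norm z) ^ degree p"
    using poly_growth_upper by blast
  obtain B where B: "B > 0" "\<And>z. (1 + norm z) ^ degree q \<le> B * (1 + norm (poly q z))"
    using poly_growth_lower[OF assms] by blast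
  show ?thesis
  proof (rule that)
    show "A ^ degree q * B ^ degree p > 0" using A B by simp
    fix z
    have "(1 + norm (poly p z)) ^ degree q \<le> (A * (1 + norm z) ^ degree p) ^ degree q"
      using A(2) by (intro power_mono) auto
    also have "\<dots> = A ^ degree q * ((1 + norm z) ^ degree q) ^ degree p"
      by (simp add: power_mult_distrib mult.commute flip: power_mult)
    also have "\<dots> \<le> A ^ degree q * (B * (1 + norm (poly q z))) ^ degree p"
      using A(1) B(2) by (intro mult_left_mono power_mono) auto
    finally show "(1 + norm (poly p z)) ^ degree q
        \<le> A ^ degree q * B ^ degree p * (1 + norm (poly q z)) ^ degree p"
      by (simp add: power_mult_distrib mult.assoc)
  qed
qed

section \<open>Lemniscates with infinitely many common points\<close>

theorem infinite_lemniscate_intersection: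
  fixes f g :: "complex poly"
  assumes deg: "degree f \<noteq> 0" "degree g \<noteq> 0"
    and inf: "infinite {z. norm (poly f z) = 1 \<and> norm (poly g z) = 1}"
  obtains c where "f ^ degree g = Polynomial.smult c (g ^ degree f)"
proof -
  define F where "F = map_poly cnj f"
  define G where "G = map_poly cnj g"
  have [simp]: "degree F = degree f" "degree G = degree g"
    by (simp_all add: F_def G_def degree_map_poly)
  have nz: "f \<noteq> 0" "g \<noteq> 0" "F \<noteq> 0" "f ^ degree g \<noteq> 0" "g ^ degree f \<noteq> 0"
    using deg by (auto simp: F_def map_poly_eq_0_iff)
  \<comment> \<open>The product is the square of \<open>norm (poly p z)\<close>, so
    \<open>w = cnj z\<close> solves both equations.\<close>
  have unit: "poly p z * poly (map_poly cnj p) (cnj z) = 1" if "norm (poly p z) = 1"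
    for p :: "complex poly" and z
    using that by (simp flip: poly_cnj complex_norm_square)
  have "{z. norm (poly f z) = 1 \<and> norm (poly g z) = 1}
      \<subseteq> {z. \<exists>w. poly f z * poly F w = 1 \<and> poly g z * poly G w = 1}"
    using unit unfolding F_def G_def by blast
  then have inf': "infinite {z. \<exists>w. poly f z * poly F w = 1 \<and> poly g z * poly G w = 1}"
    using inf finite_subset by blast
  obtain A where A: "A > 0"
    "\<And>z. (1 + norm (poly f z)) ^ degree g \<le> A * (1 + norm (poly g z)) ^ degree f"
    using poly_growth_compare[OF nz(2)] by blast
  obtain B where B: "B > 0"
    "\<And>w. (1 + norm (poly G w)) ^ degree f \<le> B * (1 + norm (poly F w)) ^ degree g"
    using poly_growth_compare[OF nz(3), of G] by auto
  have le: "norm (poly (f ^ degree g) z) \<le> A * B * norm (poly (g ^ degree f) z)"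
    if z: "z \<notin> {z. poly f z = 0} \<union> {z. poly g z = 0}" for z
  proof -
    obtain w where w: "poly f z * poly F w = 1" "poly g z * poly G w = 1"
      using infinite_common_solutions_imp_all[OF _ _ inf', of z] deg z by auto
    let ?x = "norm (poly f z)" and ?X = "norm (poly F w)"
    let ?y = "norm (poly g z)" and ?Y = "norm (poly G w)"
    \<comment> \<open>Since \<open>?X\<close> and \<open>?Y\<close> are the inverses of
      \<open>?x\<close> and \<open>?y\<close>, these identities link the estimate \<open>A\<close>
      in \<open>z\<close> to the reverse estimate \<open>B\<close> in \<open>w\<close>. The factor
      \<open>(1 + ?X) ^ degree g\<close> finally cancels, leaving a bound free of
      \<open>w\<close>.\<close>
    have xX: "?x * (1 + ?X) = 1 + ?x" and yY: "?y * (1 + ?Y) = 1 + ?y"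
      using w by (simp_all add: distrib_left flip: norm_mult)
    have "?x ^ degree g * (1 + ?X) ^ degree g = (1 + ?x) ^ degree g"
      by (simp add: xX flip: power_mult_distrib)
    also have "\<dots> \<le> A * (1 + ?y) ^ degree f" by (rule A)
    also have "\<dots> = A * ?y ^ degree f * (1 + ?Y) ^ degree f"
      by (simp add: mult.assoc flip: power_mult_distrib yY)
    also have "\<dots> \<le> A * ?y ^ degree f * (B * (1 + ?X) ^ degree g)"
      using A(1) by (intro mult_left_mono B) auto
    finally have "?x ^ degree g * (1 + ?X) ^ degree g \<le> A * B * ?y ^ degree f * (1 + ?X) ^ degree g"
      by (simp add: mult_ac)
    moreover have "(1 + ?X) ^ degree g > 0" by (simp add: add_pos_nonneg)
    ultimately show ?thesis by (simp add: norm_power)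
  qed
  have "g ^ degree f dvd f ^ degree g"
  proof (rule complex_poly_dvd_if_norm_le[OF nz(5)])
    show "finite ({z. poly f z = 0} \<union> {z. poly g z = 0})"
      by (simp add: nz poly_roots_finite)
  qed (rule le)
  then obtain r where r: "f ^ degree g = g ^ degree f * r" by (auto simp: dvd_def)
  have "r \<noteq> 0" using r nz by auto
  \<comment> \<open>Both powers have degree \<open>degree f * degree g\<close>.\<close>
  then have "degree r = 0"
    using arg_cong[OF r, of degree] nz by (simp add: degree_mult_eq degree_power_eq)
  then obtain c where "r = [:c:]" by (auto elim: degree_eq_zeroE)
  with r show ?thesis by (intro that[of c]) simp
qed

section \<open>Common zeros and their multiplicities\<close>

lemma finite_common_roots_of_unity:
  fixes f g :: "complex poly"
  assumes deg: "degree f \<noteq> 0" "degree g \<noteq> 0" and indep: "mult_independent f g"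
  shows "finite {z. \<exists>k\<ge>1. poly f z ^ k = 1 \<and> poly g z ^ k = 1}" (is "finite ?T")
proof (rule ccontr)
  assume inf: "infinite ?T"
  have unit: "norm x = 1" if "x ^ k = 1" "k \<ge> 1" for x :: complex and k
    using power_eq_1_iff[OF that(1)] that(2) by simp
  have "?T \<subseteq> {z. norm (poly f z) = 1 \<and> norm (poly g z) = 1}"
    using unit by blast
  with inf have "infinite {z. norm (poly f z) = 1 \<and> norm (poly g z) = 1}"
    using finite_subset by blast
  then obtain c where c: "f ^ degree g = Polynomial.smult c (g ^ degree f)"
    using infinite_lemniscate_intersection[OF deg] by blast
  have "?T \<noteq> {}" using inf by (metis finite.emptyI)
  then obtain z k where k: "k \<ge> 1" "poly f z ^ k = 1" "poly g z ^ k = 1"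
    by blast
  \<comment> \<open>One point of the set suffices: evaluating there and raising to the power
    \<open>k\<close> makes \<open>c\<close> a root of unity.\<close>
  have "(poly f z ^ k) ^ degree g = c ^ k * (poly g z ^ k) ^ degree f"
    using arg_cong[OF c, of "\<lambda>p. poly p z ^ k"]
    by (simp add: power_mult_distrib mult.commute flip: power_mult)
  then have "c ^ k = 1" using k by simp
  then have "f ^ (degree g * k) = g ^ (degree f * k)"
    using c by (simp add: power_mult smult_power)
  with indep deg k(1) show False unfolding mult_independent_def
    by (metis mult_le_mono nat_mult_1 less_one not_less)
qed

text \<open>The cofactor of \<open>f - f(z)\<close> in \<open>f ^ k - 1 = f ^ k - f(z) ^ k\<close> takes the nonzero value
  \<open>k f(z) ^ (k - 1)\<close> at \<open>z\<close>, so the multiplicity does not depend on \<open>k\<close>.\<close>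

lemma order_power_minus_one_le:
  fixes f :: "complex poly"
  assumes deg: "degree f \<noteq> 0" and k: "k \<ge> 1" and z: "poly f z ^ k = 1"
  shows "Polynomial.order z (f ^ k - 1) \<le> degree f"
proof -
  define c where "c = poly f z"
  define S where "S = (\<Sum>i<k. [:c:] ^ (k - Suc i) * f ^ i)"
  have "f ^ k - 1 = f ^ k - [:c:] ^ k"
    using z by (simp add: c_def poly_const_pow)
  also have "\<dots> = (f - [:c:]) * S"
    unfolding S_def by (rule power_diff_sumr2)
  finally have eq: "f ^ k - 1 = (f - [:c:]) * S" .
  have "c \<noteq> 0" using z k by (auto simp: c_def power_0_left)
  have "poly S z = (\<Sum>i<k. c ^ (k - 1))"
    unfolding S_def by (auto simp: poly_sum c_def simp flip: power_add intro!: sum.cong)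
  then have S: "poly S z \<noteq> 0" using \<open>c \<noteq> 0\<close> k by simp
  have d: "degree (f - [:c:]) = degree f"
    using deg degree_add_eq_left[of "-[:c:]" f] by (simp del: minus_pCons)
  then have "f - [:c:] \<noteq> 0" using deg by auto
  moreover have "S \<noteq> 0" using S by auto
  ultimately have "Polynomial.order z (f ^ k - 1) = Polynomial.order z (f - [:c:]) + Polynomial.order z S"
    unfolding eq by (intro order_mult) auto
  also have "Polynomial.order z S = 0" using S by (simp add: order_root)
  also have "Polynomial.order z (f - [:c:]) \<le> degree f"
    using order_degree[OF \<open>f - [:c:] \<noteq> 0\<close>] d by simp
  finally show ?thesis by simp
qed

lemma power_minus_one_neq_0:
  fixes f :: "complex poly"
  assumes "degree f \<noteq> 0" "k \<ge> 1"
  shows "f ^ k - 1 \<noteq> 0"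
proof
  assume "f ^ k - 1 = 0"
  then have "degree (f ^ k) = 0" by simp
  moreover have "f \<noteq> 0" using assms by auto
  ultimately show False using assms by (simp add: degree_power_eq)
qed

lemma poly_gcd_eq_0_iff:
  fixes p q :: "complex poly"
  shows "poly (gcd p q) z = 0 \<longleftrightarrow> poly p z = 0 \<and> poly q z = 0"
  by (simp only: poly_eq_0_iff_dvd gcd_greatest_iff)

section \<open>Common multiple and exceptional exponents\<close>

theorem theorem1p2:
  fixes f g :: "complex poly"
  assumes "degree f \<noteq> 0" and "degree g \<noteq> 0"
    and "mult_independent f g"
  shows "(\<exists>h :: complex poly. h \<noteq> 0 \<and>
           (\<forall>k :: nat. k \<ge> 1 \<longrightarrow> gcd (f ^ k - 1) (g ^ k - 1) dvd h)) \<and>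
         (gcd (f - 1) (g - 1) = 1 \<longrightarrow>
           (\<exists>D :: nat set. finite D \<and> (\<forall>d \<in> D. d \<ge> 2) \<and>
             (\<forall>k :: nat. k \<ge> 1 \<longrightarrow> k \<notin> (\<Union>d \<in> D. {d * n | n :: nat. n \<ge> 1}) \<longrightarrow>
               gcd (f ^ k - 1) (g ^ k - 1) = 1)))"
proof -
  define T where "T = {z. \<exists>k\<ge>1. poly f z ^ k = 1 \<and> poly g z ^ k = 1}"
  have fin: "finite T"
    unfolding T_def using assms by (rule finite_common_roots_of_unity)
  have root_iff: "poly (gcd (f ^ k - 1) (g ^ k - 1)) z = 0 \<longleftrightarrow> poly f z ^ k = 1 \<and> poly g z ^ k = 1"
    for k z by (simp add: poly_gcd_eq_0_iff)
  show ?thesis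
  proof (intro conjI impI)
    \<comment> \<open>All zeros of the gcds lie in \<open>T\<close>, with multiplicity at most
      \<open>degree f\<close> whatever \<open>k\<close> is.\<close>
    define h where "h = (\<Prod>z\<in>T. [:-z, 1:] ^ degree f)"
    have "h \<noteq> 0" using fin by (simp add: h_def)
    moreover have "gcd (f ^ k - 1) (g ^ k - 1) dvd h" if k: "k \<ge> 1" for k
    proof (rule complex_poly_dvd_if_order_le)
      have nz: "f ^ k - 1 \<noteq> 0" using power_minus_one_neq_0 assms(1) k by blast
      then show "gcd (f ^ k - 1) (g ^ k - 1) \<noteq> 0" by simp
      fix z assume "poly (gcd (f ^ k - 1) (g ^ k - 1)) z = 0"
      then have z: "poly f z ^ k = 1" "poly g z ^ k = 1" by (simp_all add: root_iff)
      have "Polynomial.order z (gcd (f ^ k - 1) (g ^ k - 1)) \<le> Polynomial.order z (f ^ k - 1)"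
        using nz by (intro dvd_imp_order_le) auto
      also have "\<dots> \<le> degree f" using order_power_minus_one_le assms(1) k z(1) by blast
      also have "z \<in> T" using z k by (auto simp: T_def)
      then have "[:-z, 1:] ^ degree f dvd h"
        unfolding h_def using fin by (intro dvd_prodI) auto
      then have "degree f \<le> Polynomial.order z h"
        using \<open>h \<noteq> 0\<close> order_divides by blast
      finally show "Polynomial.order z (gcd (f ^ k - 1) (g ^ k - 1)) \<le> Polynomial.order z h" .
    qed (use \<open>h \<noteq> 0\<close> in auto)
    ultimately show "\<exists>h. h \<noteq> 0 \<and> (\<forall>k\<ge>1. gcd (f ^ k - 1) (g ^ k - 1) dvd h)" by blast
  next
    assume cop: "gcd (f - 1) (g - 1) = 1"
    define e where "e = (\<lambda>z. LEAST k. k \<ge> 1 \<and> poly f z ^ k = 1 \<and> poly g z ^ k = 1)"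
    have e: "e z \<ge> 1" "poly f z ^ e z = 1" "poly g z ^ e z = 1" if "z \<in> T" for z
      using that LeastI_ex[of "\<lambda>k. k \<ge> 1 \<and> poly f z ^ k = 1 \<and> poly g z ^ k = 1"]
      unfolding T_def e_def by auto
    have e_dvd: "e z dvd k" if "z \<in> T" "poly f z ^ k = 1" "poly g z ^ k = 1" for z k
    proof -
      \<comment> \<open>The remainder \<open>k mod e z\<close> is again an exponent that sends both
        values to 1, so minimality of \<open>e z\<close> forces it to be 0.\<close>
      have "x ^ (k mod e z) = 1" if "x ^ k = 1" "x ^ e z = 1" for x :: complex
      proof -
        have "x ^ k = (x ^ e z) ^ (k div e z) * x ^ (k mod e z)"
          by (simp flip: power_mult power_add)
        with that show ?thesis by simp
      qed
      then have "poly f z ^ (k mod e z) = 1" "poly g z ^ (k mod e z) = 1"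
        using that e by blast+
      moreover have "k mod e z < e z" using e(1)[OF that(1)] by simp
      ultimately have "\<not> k mod e z \<ge> 1" using not_less_Least unfolding e_def by blast
      then show ?thesis by (simp add: dvd_eq_mod_eq_0)
    qed
    \<comment> \<open>If \<open>e z\<close> were 1, then \<open>z\<close> would be a common zero of
      \<open>f - 1\<close> and \<open>g - 1\<close>.\<close>
    have "e z \<ge> 2" if "z \<in> T" for z
    proof (rule ccontr)
      assume "\<not> e z \<ge> 2"
      with e[OF that] have "poly f z ^ 1 = 1" "poly g z ^ 1 = 1" by
        (auto simp: le_Suc_eq not_le less_2_cases_iff)
      then have "poly (gcd (f - 1) (g - 1)) z = 0" by (simp add: poly_gcd_eq_0_iff)
      with cop show False by simp
    qed
    moreover have "gcd (f ^ k - 1) (g ^ k - 1) = 1"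
      if k: "k \<ge> 1" "k \<notin> (\<Union>d \<in> e ` T. {d * n | n. n \<ge> 1})" for k
    proof (rule ccontr)
      let ?d = "gcd (f ^ k - 1) (g ^ k - 1)"
      assume "?d \<noteq> 1"
      moreover have "?d \<noteq> 0" using power_minus_one_neq_0[OF assms(1) k(1)] by simp
      \<comment> \<open>The gcd is normalised, so a nonzero constant value could only be 1.\<close>
      ultimately have "degree ?d \<noteq> 0"
        by (metis is_unit_gcd is_unit_iff_degree coprime_iff_gcd_eq_1)
      then obtain z where "poly ?d z = 0"
        by (metis constant_degree fundamental_theorem_of_algebra)
      then have z: "poly f z ^ k = 1" "poly g z ^ k = 1" by (simp_all add: root_iff)
      then have "z \<in> T" using k by (auto simp: T_def)
      with e_dvd z obtain n where "k = e z * n" by (auto simp: dvd_def)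
      moreover from this have "n \<ge> 1" using k(1) by (cases n) auto
      ultimately show False using k(2) \<open>z \<in> T\<close> by blast
    qed
    ultimately show "\<exists>D. finite D \<and> (\<forall>d\<in>D. d \<ge> 2) \<and>
        (\<forall>k\<ge>1. k \<notin> (\<Union>d\<in>D. {d * n | n. n \<ge> 1}) \<longrightarrow> gcd (f ^ k - 1) (g ^ k - 1) = 1)"
      using fin by (intro exI[of _ "e ` T"]) auto
  qed
qed

end
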